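(* For all positive integers $a,r,s$ with $s\geq r+1$ and all integers $n\geq 2r(s+2)+ r(s+2)\sqrt{s-1}$, \[\mathrm{ex}_{\Pi}\left(n, s, \Sigma_{r,0}(a,s)\right) = \Pi_{r,0}(a,n).\] Furthermore, the set of multigraphs $G\in\mathcal{F}(n,s,\Sigma_{r,0}(a,s))$ with $P(G)=\mathrm{ex}_{\Pi}(n,s,\Sigma_{r,0}(a,s))$ is precisely the family $T^P_{r,0}(a,n)$.
   Context: A multigraph is a pair $G=(V,w)$ where $V$ is a finite set and $w:\binom{V}{2}\to\mathbb{Z}_{\geq 0}$. For $X\subseteq V$ write $e(G[X])=\sum_{xy\in\binom{X}{2}}w(xy)$, $e(G)=e(G[V])$ and $P(G)=\prod_{xy\in\binom{V}{2}}w(xy)$. Given integers $s\geq 2$, $q\geq 0$, $\mathcal{F}(n,s,q)$ denotes the set of multigraphs on vertex set $[n]=\{1,\dots,n\}$ in which every $s$-set $X$ of vertices satisfies $e(G[X])\leq q$, and $\mathrm{ex}_{\Pi}(n,s,q)=\max\{P(G): G\in\mathcal{F}(n,s,q)\}$. For positive integers $a,r$, $d\in\{0,\dots,a-1\}$ and $n$, $\mathcal{T}_{r,d}(a,n)$ is the set of multigraphs $G$ on $[n]$ whose vertex set can be partitioned into $r$ parts $V_0,\dots,V_{r-1}$ such that all pairs inside $V_0$ have multiplicity $a-d$, all pairs inside $V_i$ ($1\le i\le r-1$) have multiplicity $a$, and all other pairs have multiplicity $a+1$. $\Sigma_{r,d}(a,n)=\max\{e(G):G\in\mathcal{T}_{r,d}(a,n)\}$,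 $\Pi_{r,d}(a,n)=\max\{P(G):G\in\mathcal{T}_{r,d}(a,n)\}$, and $T^P_{r,d}(a,n)$ is the set of $G\in\mathcal{T}_{r,d}(a,n)$ with $P(G)=\Pi_{r,d}(a,n)$. *)

theory Defs
  imports Complex_Main "HOL-Library.FuncSet" "HOL-Library.Disjoint_Sets" "HOL-Library.Ramsey"
begin

type_synonym 'a multigraph = "'a set \<times> ('a set \<Rightarrow> nat)"

(* Multiplicity functions are extensional on the pairs of vertices, so equality of multigraphs
   is equality of vertex sets and of multiplicities. *)
definition multigraph :: "'a multigraph \<Rightarrow> bool" where
  "multigraph G \<longleftrightarrow> finite (fst G) \<and> snd G \<in> nsets (fst G) 2 \<rightarrow>\<^sub>E UNIV"

definition edges_in :: "'a multigraph \<Rightarrow> 'a set \<Rightarrow> nat" where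
  "edges_in G X = (\<Sum>p\<in>nsets X 2. snd G p)"

definition edges :: "'a multigraph \<Rightarrow> nat" where
  "edges G = edges_in G (fst G)"

definition edge_prod :: "'a multigraph \<Rightarrow> nat" where
  "edge_prod G = (\<Prod>p\<in>nsets (fst G) 2. snd G p)"

definition multigraphs_on :: "nat \<Rightarrow> nat multigraph set" where
  "multigraphs_on n = {G. multigraph G \<and> fst G = {1..n}}"

definition bounded_family :: "nat \<Rightarrow> nat \<Rightarrow> nat \<Rightarrow> nat multigraph set" where
  "bounded_family n s q = {G \<in> multigraphs_on n. \<forall>X \<in> nsets {1..n} s. edges_in G X \<le> q}"

(* For n < s or s < 2 the family may be infinite, and then the Max below is unspecified. *)
definition ex_prod :: "nat \<Rightarrow> nat \<Rightarrow> nat \<Rightarrow> nat" where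
  "ex_prod n s q = Max (edge_prod ` bounded_family n s q)"

(* Parts may be empty, so that the family is nonempty for every n, including n < r. *)
definition turan_family :: "nat \<Rightarrow> nat \<Rightarrow> nat \<Rightarrow> nat \<Rightarrow> nat multigraph set" where
  "turan_family r d a n = {G \<in> multigraphs_on n.
     \<exists>V :: nat \<Rightarrow> nat set.
       (\<Union>i<r. V i) = {1..n} \<and> disjoint_family_on V {..<r} \<and>
       (\<forall>p \<in> nsets (V 0) 2. snd G p = a - d) \<and>
       (\<forall>i \<in> {1..<r}. \<forall>p \<in> nsets (V i) 2. snd G p = a) \<and>
       (\<forall>p \<in> nsets {1..n} 2. (\<forall>i<r. \<not> p \<subseteq> V i) \<longrightarrow> snd G p = a + 1)}"

definition turan_sum :: "nat \<Rightarrow> nat \<Rightarrow> nat \<Rightarrow> nat \<Rightarrow> nat" where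
  "turan_sum r d a n = Max (edges ` turan_family r d a n)"

definition turan_prod :: "nat \<Rightarrow> nat \<Rightarrow> nat \<Rightarrow> nat \<Rightarrow> nat" where
  "turan_prod r d a n = Max (edge_prod ` turan_family r d a n)"

definition turan_prod_extremal :: "nat \<Rightarrow> nat \<Rightarrow> nat \<Rightarrow> nat \<Rightarrow> nat multigraph set" where
  "turan_prod_extremal r d a n = {G \<in> turan_family r d a n. edge_prod G = turan_prod r d a n}"

end

theory Submission
  imports Defs
begin

text \<open>Let \<open>t\<close> denote the number of edges of the balanced complete \<open>r\<close>-partite graph and measure
  every multiplicity by its excess over \<open>a\<close>. If all \<open>s\<close>-sets have total excess at most \<open>t(s)\<close>,
  then averaging over vertex deletions gives total excess at most \<open>t(m)\<close> for all larger sets. Since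
  \<open>w \<le> a ((a + 1) / a)\<close> to the power \<open>w - a\<close> for every integer \<open>w\<close>, with equality only for
  \<open>w \<in> {a, a + 1}\<close>, this bounds the product. In the case of equality the pairs of multiplicity
  \<open>a + 1\<close> form a graph with \<open>t(n)\<close> edges and hence minimum degree at least \<open>t(n) - t(n - 1)\<close>.
  As \<open>n \<ge> 2 r s\<close>, this minimum degree lets one descend from \<open>s\<close>-sets to smaller sets until one sees
  that there is no clique on \<open>r + 1\<close> vertices; Zykov symmetrization then shows that
  non-adjacency is an equivalence relation with at most \<open>r\<close> classes.\<close>

section \<open>Pair sums and degrees\<close>

text \<open>Weights are integers because a multiplicity may lie below \<open>a\<close>, which makes
  its excess negative.\<close>

definition pair_sum :: "('a set \<Rightarrow> int) \<Rightarrow> 'a set \<Rightarrow> int" where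
  "pair_sum f X = (\<Sum>p\<in>nsets X 2. f p)"

definition degree_in :: "('a set \<Rightarrow> int) \<Rightarrow> 'a set \<Rightarrow> 'a \<Rightarrow> int" where
  "degree_in f X v = (\<Sum>u\<in>X - {v}. f {u, v})"

lemma doubleton_in_nsets_2:
  "u \<in> X \<Longrightarrow> v \<in> X \<Longrightarrow> u \<noteq> v \<Longrightarrow> {u, v} \<in> nsets X 2"
  by (auto simp: nsets_def)

lemma nsets_2_cases:
  assumes "p \<in> nsets X 2"
  obtains u v where "p = {u, v}" "u \<in> X" "v \<in> X" "u \<noteq> v"
  using assms by (auto simp: nsets_def card_2_iff)

lemma card_nsets: "finite X \<Longrightarrow> card (nsets X k) = card X choose k"
proof -
  assume "finite X"
  then have "nsets X k = {B. B \<subseteq> X \<and> card B = k}"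
    by (auto simp: nsets_def intro: finite_subset)
  with \<open>finite X\<close> show ?thesis by (simp add: n_subsets)
qed

lemma nsets_2_insert:
  "v \<notin> X \<Longrightarrow> nsets (insert v X) 2 = nsets X 2 \<union> (\<lambda>u. {u, v}) ` X"
  by (auto elim!: nsets_2_cases simp: nsets_def card_2_iff)

lemma pair_sum_insert:
  assumes "finite X" "v \<notin> X"
  shows "pair_sum f (insert v X) = pair_sum f X + (\<Sum>u\<in>X. f {u, v})"
proof -
  have inj: "inj_on (\<lambda>u. {u, v}) X"
    using assms by (auto simp: inj_on_def doubleton_eq_iff)
  have "nsets X 2 \<inter> (\<lambda>u. {u, v}) ` X = {}"
    using assms by (auto simp: nsets_def)
  then show ?thesis
    using assms inj by (simp add: pair_sum_def nsets_2_insert sum.union_disjoint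
        finite_imp_finite_nsets sum.reindex)
qed

lemma pair_sum_remove:
  assumes "finite X" "v \<in> X"
  shows "pair_sum f X = pair_sum f (X - {v}) + degree_in f X v"
  using pair_sum_insert[of "X - {v}" v f] assms by (simp add: degree_in_def insert_absorb)

lemma degree_in_insert:
  assumes "finite X" "v \<notin> X" "u \<in> X"
  shows "degree_in f (insert v X) u = degree_in f X u + f {u, v}"
proof -
  have "insert v X - {u} = insert v (X - {u})" using assms by auto
  then show ?thesis using assms by (simp add: degree_in_def insert_commute)
qed

lemma sum_degree_in: "finite X \<Longrightarrow> (\<Sum>v\<in>X. degree_in f X v) = 2 * pair_sum f X"
proof (induction X rule: finite_induct)
  case empty
  have "nsets {} 2 = ({} :: 'a set set)" by (auto simp: nsets_def)
  then show ?case by (simp add: pair_sum_def)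
next
  case (insert v X)
  have "(\<Sum>u\<in>X. degree_in f (insert v X) u) = (\<Sum>u\<in>X. degree_in f X u) + (\<Sum>u\<in>X. f {u, v})"
    using insert by (simp add: degree_in_insert sum.distrib)
  moreover have "degree_in f (insert v X) v = (\<Sum>u\<in>X. f {u, v})"
    using insert by (simp add: degree_in_def)
  ultimately show ?case
    using insert by (simp add: pair_sum_insert)
qed

text \<open>Each pair survives every deletion except those of its two ends.\<close>

lemma sum_pair_sum_remove:
  assumes "finite X"
  shows "(\<Sum>v\<in>X. pair_sum f (X - {v})) = (int (card X) - 2) * pair_sum f X"
proof -
  have "(\<Sum>v\<in>X. pair_sum f (X - {v})) = (\<Sum>v\<in>X. pair_sum f X - degree_in f X v)"
    using assms by (intro sum.cong refl) (simp add: pair_sum_remove)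
  also have "\<dots> = (int (card X) - 2) * pair_sum f X"
    using assms by (simp add: sum_subtractf sum_degree_in algebra_simps)
  finally show ?thesis .
qed

text \<open>A single missing pair brings a set of \<open>r + 1\<close> vertices down to its Turan
  number; colourings and clones are shown clique-free in this way.\<close>

lemma pair_sum_le_choose:
  assumes "finite X" "\<And>p. p \<in> nsets X 2 \<Longrightarrow> f p \<le> 1" "p0 \<in> nsets X 2" "f p0 = 0"
  shows "pair_sum f X \<le> int (card X choose 2) - 1"
proof -
  have fin: "finite (nsets X 2)" using assms by (simp add: finite_imp_finite_nsets)
  have "pair_sum f X = f p0 + (\<Sum>p\<in>nsets X 2 - {p0}. f p)"
    unfolding pair_sum_def using fin assms by (simp add: sum.remove)
  also have "(\<Sum>p\<in>nsets X 2 - {p0}. f p) \<le> (\<Sum>p\<in>nsets X 2 - {p0}. 1)"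
    using assms(2) by (intro sum_mono) auto
  also have "\<dots> = int (card (nsets X 2)) - 1"
    using sum.remove[OF fin assms(3), of "\<lambda>_. 1 :: int"] by simp
  finally show ?thesis using assms(1,4) by (simp add: card_nsets)
qed

section \<open>Turan numbers\<close>

text \<open>The increment \<open>i - i div r\<close> is the minimum degree of the balanced complete
  \<open>r\<close>-partite graph on \<open>i + 1\<close> vertices.\<close>

definition turan_number :: "nat \<Rightarrow> nat \<Rightarrow> int" where
  "turan_number r m = (\<Sum>i<m. int i - int (i div r))"

lemma turan_number_Suc:
  "turan_number r (Suc m) = turan_number r m + int m - int (m div r)"
  by (simp add: turan_number_def)

text \<open>With \<open>k = m div r\<close> and \<open>j = m mod r\<close>, the balanced partition
  has \<open>j\<close> parts of size \<open>k + 1\<close> and \<open>r - j\<close> parts of size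
  \<open>k\<close>; subtracting the squares of the sizes from \<open>m * m\<close> gives the right
  side. Doubling avoids a division.\<close>

lemma turan_number_closed:
  assumes "r \<ge> 1"
  shows "2 * turan_number r m =
    int m * int m - int (m div r) * (int m + int (m mod r)) - int (m mod r)"
proof (induction m)
  case 0
  then show ?case by (simp add: turan_number_def)
next
  case (Suc m)
  define k j where "k = int (m div r)" and "j = int (m mod r)"
  have m: "int m = k * int r + j"
    unfolding k_def j_def by (metis div_mult_mod_eq of_nat_add of_nat_mult)
  have IH: "2 * turan_number r m = int m * int m - k * (int m + j) - j"
    using Suc by (simp add: k_def j_def)
  show ?case
  proof (cases "Suc (m mod r) = r")
    case True
    have r: "int r = j + 1" using True unfolding j_def by linarith
    have d: "int (Suc m div r) = k + 1" "Suc m mod r = 0"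
      using True by (auto simp: div_Suc mod_Suc k_def)
    show ?thesis unfolding d turan_number_Suc using IH m r
      by (simp add: k_def[symmetric] algebra_simps)
  next
    case False
    have d: "int (Suc m div r) = k" "int (Suc m mod r) = j + 1"
      using False by (auto simp: div_Suc mod_Suc k_def j_def)
    show ?thesis unfolding d turan_number_Suc using IH
      by (simp add: k_def[symmetric] algebra_simps)
  qed
qed

text \<open>By the closed form the right side exceeds the left by exactly
  \<open>(k + 1) * (j + 1) - 2\<close>. This vanishes at \<open>m = r\<close>, where
  \<open>k = 1\<close> and \<open>j = 0\<close>, and is positive beyond.\<close>

lemma turan_number_step:
  assumes "r \<ge> 1" "m \<ge> r + 1"
  shows "(int m + 1) * turan_number r m < (int m - 1) * (turan_number r (Suc m) + 1)"
proof -
  define k j t where "k = int (m div r)" and "j = int (m mod r)" and "t = turan_number r m"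
  have m: "int m = k * int r + j"
    unfolding k_def j_def by (metis div_mult_mod_eq of_nat_add of_nat_mult)
  have t: "2 * t = int m * int m - k * (int m + j) - j"
    unfolding t_def k_def j_def using turan_number_closed[OF assms(1)] by blast
  have j: "j \<ge> 0" by (simp add: j_def)
  have k: "k \<ge> 1"
    using assms div_le_mono[of r m r] by (simp add: k_def)
  have "k \<ge> 2 \<or> j \<ge> 1"
  proof (rule ccontr)
    assume "\<not> ?thesis"
    then have "k = 1" "j = 0" using j k by auto
    then show False using m assms by simp
  qed
  then have "(k + 1) * (j + 1) > 2"
  proof
    assume "k \<ge> 2"
    have "(k + 1) * (j + 1) \<ge> (k + 1) * 1" using k j by (intro mult_left_mono) auto
    then have "(k + 1) * (j + 1) \<ge> k + 1" by simp
    then show ?thesis using \<open>k \<ge> 2\<close> by linarith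
  next
    assume "j \<ge> 1"
    have "(1 + 1) * (1 + 1) \<le> (k + 1) * (j + 1)" using k \<open>j \<ge> 1\<close> by (intro mult_mono) auto
    then show ?thesis by simp
  qed
  moreover have "(int m - 1) * (t + int m - k + 1) - (int m + 1) * t = (k + 1) * (j + 1) - 2"
    using t by (simp add: algebra_simps)
  ultimately show ?thesis
    unfolding turan_number_Suc k_def[symmetric] t_def[symmetric] by linarith
qed

text \<open>Here \<open>e\<close> stands for the pair sum of an \<open>m\<close>-set above its Turan
  number. The left side bounds the degree sum over that set: \<open>2 * e\<close> from inside and at
  most \<open>turan_number r (Suc m) - e\<close> from each outside vertex. The right side is what
  the minimum degree demands.\<close>

lemma turan_number_degree_gap:
  assumes "r \<ge> 1" "m \<ge> 1" "n \<ge> 2 * r * (m + 1)" "e \<ge> turan_number r m + 1"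
  shows "2 * e + (int n - int m) * (turan_number r (Suc m) - e) <
    int m * (turan_number r n - turan_number r (n - 1))"
proof -
  define k j t where "k = int (m div r)" and "j = int (m mod r)" and "t = turan_number r m"
  have m: "int m = k * int r + j"
    unfolding k_def j_def by (metis div_mult_mod_eq of_nat_add of_nat_mult)
  have t: "2 * t = int m * int m - k * (int m + j) - j"
    unfolding t_def k_def j_def using turan_number_closed[OF assms(1)] by blast
  have j: "j \<ge> 0" "j < int r" "k \<ge> 0" using assms by (auto simp: j_def k_def)
  have n: "int n \<ge> 2 * int r * (int m + 1)"
    using of_nat_mono[OF assms(3), where 'a = int] by (simp add: algebra_simps)
  have "int r * (int m + 1) \<ge> 1 * (int m + 1)" using assms by (intro mult_right_mono) auto
  then have nm: "int n - int m \<ge> 2" using n assms(2) by (simp add: algebra_simps)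
  define d where "d = int ((n - 1) div r)"
  have d: "int r * d \<le> int n - 1"
  proof -
    have "r * ((n - 1) div r) \<le> n - 1" by simp
    then have "int r * d \<le> int (n - 1)" unfolding d_def by (metis of_nat_le_iff of_nat_mult)
    then show ?thesis using nm by (simp add: of_nat_diff)
  qed
  have tn: "turan_number r n - turan_number r (n - 1) = int n - 1 - d"
  proof -
    have "n = Suc (n - 1)" using nm by linarith
    then show ?thesis using turan_number_Suc[of r "n - 1"] by (simp add: d_def)
  qed
  \<comment> \<open>As \<open>n - m \<ge> 2\<close>, the left side does not increase with
    \<open>e\<close>, so the worst case is \<open>e = t + 1\<close>.\<close>
  have "(int n - int m - 2) * (t + 1) \<le> (int n - int m - 2) * e"
    using nm assms(4) by (intro mult_left_mono) (auto simp: t_def)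
  then have "2 * e + (int n - int m) * (t + int m - k - e)
      \<le> 2 * (t + 1) + (int n - int m) * (t + int m - k - (t + 1))"
    by (simp add: algebra_simps)
  also have "\<dots> = int n * (int m - k - 1) + int m + 2 - (k + 1) * j"
    using t by (simp add: algebra_simps)
  finally have up: "2 * e + (int n - int m) * (t + int m - k - e) \<le> \<dots>" .
  \<comment> \<open>Multiplying by \<open>r\<close> removes the floor in \<open>d\<close> through
    \<open>r * d \<le> n - 1\<close>. What remains is \<open>n * (r - j) \<ge> n\<close>, which
    together with \<open>m \<ge> 1\<close> outweighs \<open>2 * r * (m + 1)\<close>.\<close>
  have "int r * (int n * (int m - k - 1) + int m + 2 - (k + 1) * j)
      < int m * (int r * (int n - 1) - (int n - 1))"
  proof -
    have "int m * (int r * (int n - 1) - (int n - 1)) -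
        int r * (int n * (int m - k - 1) + int m + 2 - (k + 1) * j) =
        int n * (k * int r + int r - int m) + int m - 2 * int r * (int m + 1) + int r * ((k + 1) * j)"
      by (simp add: algebra_simps)
    also have "k * int r + int r - int m = int r - j" using m by simp
    finally have eq: "int m * (int r * (int n - 1) - (int n - 1)) -
        int r * (int n * (int m - k - 1) + int m + 2 - (k + 1) * j) =
        int n * (int r - j) + int m - 2 * int r * (int m + 1) + int r * ((k + 1) * j)" .
    have "int n * (int r - j) \<ge> int n * 1" using j by (intro mult_left_mono) auto
    moreover have "int r * ((k + 1) * j) \<ge> 0" using j by simp
    ultimately show ?thesis using eq n assms(2) by linarith
  qed
  also have "\<dots> \<le> int m * (int r * (int n - 1) - int r * d)"
    using d by (intro mult_left_mono) auto
  also have "\<dots> = int r * (int m * (int n - 1 - d))" by (simp add: algebra_simps)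
  finally have "int n * (int m - k - 1) + int m + 2 - (k + 1) * j < int m * (int n - 1 - d)"
    using assms(1) by (simp add: mult_less_cancel_left)
  with up show ?thesis
    unfolding tn turan_number_Suc k_def[symmetric] t_def[symmetric] by linarith
qed

text \<open>The first \<open>r\<close> vertices lose no pair, and the next one loses exactly one, as
  \<open>r div r = 1\<close>.\<close>

lemma turan_number_clique:
  assumes "r \<ge> 1"
  shows "turan_number r (r + 1) = int ((r + 1) choose 2) - 1"
proof -
  have small: "m \<le> r \<Longrightarrow> turan_number r m = int (m choose 2)" for m
  proof (induction m)
    case 0
    then show ?case by (simp add: turan_number_def)
  next
    case (Suc m)
    then show ?case by (simp add: turan_number_Suc numeral_2_eq_2)
  qed
  show ?thesis using assms small[of r] turan_number_Suc[of r r]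
    by (simp add: numeral_2_eq_2)
qed

text \<open>The average of the pair sums over the sets \<open>X - {v}\<close> is below the value that would
  permit \<open>pair_sum f X = turan_number r (card X) + 1\<close>.\<close>

lemma pair_sum_le_turan_number:
  assumes r: "r \<ge> 1" and s: "s \<ge> r + 1" and "finite V"
    and bound: "\<And>X. X \<subseteq> V \<Longrightarrow> card X = s \<Longrightarrow> pair_sum f X \<le> turan_number r s"
    and "X \<subseteq> V" "card X \<ge> s"
  shows "pair_sum f X \<le> turan_number r (card X)"
proof -
  have "X \<subseteq> V \<Longrightarrow> card X = m \<Longrightarrow> pair_sum f X \<le> turan_number r m" if "m \<ge> s" for m X
    using that
  proof (induction m arbitrary: X rule: dec_induct)
    case base
    then show ?case using bound by blast
  next
    case (step m)
    have fin: "finite X" using step.prems \<open>finite V\<close> finite_subset by blast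
    have "(int (Suc m) - 2) * pair_sum f X = (\<Sum>v\<in>X. pair_sum f (X - {v}))"
      using sum_pair_sum_remove[OF fin, of f] step.prems by simp
    also have "\<dots> \<le> (\<Sum>v\<in>X. turan_number r m)"
    proof (intro sum_mono)
      fix v assume "v \<in> X"
      then show "pair_sum f (X - {v}) \<le> turan_number r m"
        using step.prems fin by (intro step.IH) auto
    qed
    also have "\<dots> = (int m + 1) * turan_number r m"
      using step.prems by (simp add: algebra_simps)
    also have "\<dots> < (int m - 1) * (turan_number r (Suc m) + 1)"
      using turan_number_step[OF r, of m] step.hyps s by linarith
    finally have "(int m - 1) * pair_sum f X < (int m - 1) * (turan_number r (Suc m) + 1)"
      by (simp add: algebra_simps)
    moreover have "int m - 1 > 0" using step.hyps s r by linarith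
    ultimately show ?case by (simp add: mult_less_cancel_left)
  qed
  then show ?thesis using assms by blast
qed

section \<open>Extremal weightings have no clique on \<open>r + 1\<close> vertices\<close>

text \<open>Pairs inside \<open>H\<close> count twice. The share of an outside vertex
  \<open>u\<close> is written as a gain in pair sum, so that bounds for sets one larger than
  \<open>H\<close> apply to it.\<close>

lemma sum_degree_in_subset:
  assumes "finite V" "H \<subseteq> V"
  shows "(\<Sum>v\<in>H. degree_in f V v) =
    2 * pair_sum f H + (\<Sum>u\<in>V - H. pair_sum f (insert u H) - pair_sum f H)"
proof -
  have finH: "finite H" using assms finite_subset by blast
  have "degree_in f V v = degree_in f H v + (\<Sum>u\<in>V - H. f {v, u})" if "v \<in> H" for v
  proof -
    have "V - {v} = (H - {v}) \<union> (V - H)" using that assms by auto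
    then have "degree_in f V v = (\<Sum>u\<in>H - {v}. f {u, v}) + (\<Sum>u\<in>V - H. f {u, v})"
      unfolding degree_in_def using assms(1) finH by (simp, subst sum.union_disjoint) auto
    then show ?thesis by (simp add: degree_in_def insert_commute)
  qed
  then have "(\<Sum>v\<in>H. degree_in f V v) =
      (\<Sum>v\<in>H. degree_in f H v) + (\<Sum>v\<in>H. \<Sum>u\<in>V - H. f {v, u})"
    by (simp add: sum.distrib)
  also have "(\<Sum>v\<in>H. \<Sum>u\<in>V - H. f {v, u}) = (\<Sum>u\<in>V - H. \<Sum>v\<in>H. f {v, u})"
    by (rule sum.swap)
  also have "\<dots> = (\<Sum>u\<in>V - H. pair_sum f (insert u H) - pair_sum f H)"
    using finH by (intro sum.cong) (auto simp: pair_sum_insert)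
  finally show ?thesis using finH by (simp add: sum_degree_in)
qed

text \<open>A set \<open>H\<close> of size \<open>m\<close> above the Turan number receives few edges from each outside vertex,
  as the sets of size \<open>m + 1\<close> are not above it; this contradicts the minimum degree of an
  extremal weighting.\<close>

lemma extremal_clique_free:
  assumes r: "r \<ge> 1" and s: "s \<ge> r + 1" and fin: "finite V"
    and n: "card V \<ge> 2 * r * s"
    and bound: "\<And>X. X \<subseteq> V \<Longrightarrow> card X = s \<Longrightarrow> pair_sum f X \<le> turan_number r s"
    and ext: "pair_sum f V = turan_number r (card V)"
    and "H \<subseteq> V" "card H = r + 1"
  shows "pair_sum f H \<le> turan_number r (r + 1)"
proof -
  \<comment> \<open>Strictness leaves at least \<open>s\<close> vertices after one deletion, as the
    averaging bound requires.\<close>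
  have "1 * s < 2 * r * s" using r s by (intro mult_strict_right_mono) auto
  then have sn: "s < card V" using n by linarith
  \<comment> \<open>Deleting \<open>v\<close> leaves at most the Turan number of the smaller set, so
    the degree of \<open>v\<close> makes up the difference.\<close>
  have mindeg: "degree_in f V v \<ge> turan_number r (card V) - turan_number r (card V - 1)"
    if "v \<in> V" for v
  proof -
    have "pair_sum f (V - {v}) \<le> turan_number r (card (V - {v}))"
      using sn that fin by (intro pair_sum_le_turan_number[OF r s fin bound]) auto
    then show ?thesis using pair_sum_remove[OF fin that, of f] ext that fin by simp
  qed
  \<comment> \<open>The induction runs downwards from \<open>m = s\<close>, so its hypothesis speaks
    of sets with one more vertex.\<close>
  have "H \<subseteq> V \<Longrightarrow> card H = m \<Longrightarrow> pair_sum f H \<le> turan_number r m"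
    if "m \<le> s" "r + 1 \<le> m" for m H
    using that
  proof (induction m arbitrary: H rule: inc_induct)
    case base
    then show ?case using bound by blast
  next
    case (step m)
    have finH: "finite H" using step.prems fin finite_subset by blast
    show ?case
    proof (rule ccontr)
      assume "\<not> ?thesis"
      then have e: "pair_sum f H \<ge> turan_number r m + 1" by linarith
      have "2 * r * (m + 1) \<le> 2 * r * s" using step.hyps by (intro mult_left_mono) auto
      then have "2 * pair_sum f H + (int (card V) - int m) * (turan_number r (Suc m) - pair_sum f H)
          < int m * (turan_number r (card V) - turan_number r (card V - 1))"
        using step.prems n by (intro turan_number_degree_gap[OF r _ _ e]) auto
      also have "\<dots> = (\<Sum>v\<in>H. turan_number r (card V) - turan_number r (card V - 1))"
        using step.prems by simp
      also have "\<dots> \<le> (\<Sum>v\<in>H. degree_in f V v)"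
        using mindeg step.prems by (intro sum_mono) auto
      also have "\<dots> = 2 * pair_sum f H + (\<Sum>u\<in>V - H. pair_sum f (insert u H) - pair_sum f H)"
        using fin step.prems by (simp add: sum_degree_in_subset)
      also have "(\<Sum>u\<in>V - H. pair_sum f (insert u H) - pair_sum f H)
          \<le> (\<Sum>u\<in>V - H. turan_number r (Suc m) - pair_sum f H)"
      proof (intro sum_mono diff_right_mono)
        fix u assume "u \<in> V - H"
        then show "pair_sum f (insert u H) \<le> turan_number r (Suc m)"
          using step.prems finH by (intro step.IH) auto
      qed
      also have "\<dots> = (int (card V) - int m) * (turan_number r (Suc m) - pair_sum f H)"
        using step.prems finH card_mono[OF fin step.prems(1)]
        by (simp add: card_Diff_subset of_nat_diff)
      finally show False by simp
    qed
  qed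
  then show ?thesis using assms by blast
qed

section \<open>Uniqueness in Turan's theorem\<close>

text \<open>For weights 0 and 1 the middle condition says that no \<open>r + 1\<close> vertices form
  a clique, as \<open>turan_number r (r + 1)\<close> is one less than the number of pairs.\<close>

definition turan_extremal :: "nat \<Rightarrow> 'a set \<Rightarrow> ('a set \<Rightarrow> int) \<Rightarrow> bool" where
  "turan_extremal r V f \<longleftrightarrow> (\<forall>p\<in>nsets V 2. f p \<in> {0, 1}) \<and>
     (\<forall>X. X \<subseteq> V \<longrightarrow> card X = r + 1 \<longrightarrow> pair_sum f X \<le> turan_number r (r + 1)) \<and>
     pair_sum f V = turan_number r (card V)"

text \<open>Zykov symmetrization, replacing \<open>y\<close> by a copy of \<open>x\<close>; the value 0 makes the two copies
  non-adjacent.\<close>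

definition clone :: "'a \<Rightarrow> 'a \<Rightarrow> ('a set \<Rightarrow> int) \<Rightarrow> 'a set \<Rightarrow> int" where
  "clone x y f p = (if inj_on (id(y := x)) p then f (id(y := x) ` p) else 0)"

lemma clone_doubleton:
  "u \<noteq> x \<Longrightarrow> u \<noteq> y \<Longrightarrow> clone x y f {u, y} = f {u, x}"
  "x \<noteq> y \<Longrightarrow> clone x y f {x, y} = 0"
  by (auto simp: clone_def inj_on_def)

lemma clone_unchanged: "y \<notin> p \<Longrightarrow> clone x y f p = f p"
proof -
  assume "y \<notin> p"
  then have "inj_on (id(y := x)) p" "id(y := x) ` p = p" by (auto simp: inj_on_def)
  then show ?thesis by (simp add: clone_def)
qed

lemma pair_sum_clone_inj:
  assumes "inj_on (id(y := x)) X"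
  shows "pair_sum (clone x y f) X = pair_sum f (id(y := x) ` X)"
proof -
  let ?g = "id(y := x)"
  have sub: "inj_on ?g p" if "p \<in> nsets X 2" for p
    using that assms by (auto simp: nsets_def intro: inj_on_subset)
  have eq: "nsets (?g ` X) 2 = (\<lambda>p. ?g ` p) ` nsets X 2"
    using assms by (metis bij_betw_def bij_betw_imp_surj_on bij_betw_nsets)
  have inj: "inj_on (\<lambda>p. ?g ` p) (nsets X 2)"
    using assms by (intro inj_on_subset[OF inj_on_image_Pow[OF assms]]) (auto simp: nsets_def)
  show ?thesis
    unfolding pair_sum_def eq using sub by (subst sum.reindex[OF inj]) (auto simp: clone_def)
qed

lemma clone_in_01:
  assumes "\<forall>p\<in>nsets V 2. f p \<in> {0, 1}" "x \<in> V" "p \<in> nsets V 2"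
  shows "clone x y f p \<in> {0, 1}"
proof (cases "inj_on (id(y := x)) p")
  case True
  then have "id(y := x) ` p \<in> nsets V 2"
    using assms(2,3) card_image[OF True] by (auto simp: nsets_def simp del: fun_upd_apply)
      (auto split: if_splits)
  then show ?thesis using assms True by (auto simp: clone_def)
qed (simp add: clone_def)

text \<open>If \<open>X\<close> lacks one of the twins, its image under the substitution is an
  \<open>r + 1\<close>-set of the original weighting. If it contains both, the pair
  \<open>{x, y}\<close> is missing.\<close>

lemma clone_clique_free:
  assumes "r \<ge> 1" "finite V" "x \<in> V" and f01: "\<forall>p\<in>nsets V 2. f p \<in> {0, 1}"
    and free: "\<And>X. X \<subseteq> V \<Longrightarrow> card X = r + 1 \<Longrightarrow> pair_sum f X \<le> turan_number r (r + 1)"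
    and X: "X \<subseteq> V" "card X = r + 1"
  shows "pair_sum (clone x y f) X \<le> turan_number r (r + 1)"
proof (cases "inj_on (id(y := x)) X")
  case True
  then have "pair_sum (clone x y f) X = pair_sum f (id(y := x) ` X)"
    by (rule pair_sum_clone_inj)
  also have "\<dots> \<le> turan_number r (r + 1)"
    using X card_image[OF True] assms(3) by (intro free) (simp_all only:, auto)
  finally show ?thesis .
next
  case False
  then have xy: "x \<in> X" "y \<in> X" "x \<noteq> y"
    by (auto simp: inj_on_def split: if_splits)
  have finX: "finite X" using X \<open>finite V\<close> finite_subset by blast
  have "clone x y f p \<le> 1" if "p \<in> nsets X 2" for p
    using clone_in_01[OF f01 assms(3), of p y] that nsets_mono[OF X(1)] by fastforce
  then have "pair_sum (clone x y f) X \<le> int (card X choose 2) - 1"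
    using xy clone_doubleton(2)[of x y f]
    by (intro pair_sum_le_choose[OF finX, of _ "{x, y}"]) (auto intro: doubleton_in_nsets_2)
  then show ?thesis using X turan_number_clique[OF assms(1)] by simp
qed

text \<open>Only pairs at \<open>y\<close> change: its degree is exchanged for that of
  \<open>x\<close>. The pair \<open>{x, y}\<close> has weight 0 before and after.\<close>

lemma pair_sum_clone:
  assumes "finite V" "x \<in> V" "y \<in> V" "x \<noteq> y" "f {x, y} = 0"
  shows "pair_sum (clone x y f) V = pair_sum f V - degree_in f V y + degree_in f V x"
proof -
  have "pair_sum (clone x y f) (V - {y}) = pair_sum f (V - {y})"
    unfolding pair_sum_def by (intro sum.cong) (auto simp: nsets_def intro!: clone_unchanged)
  moreover have "degree_in (clone x y f) V y = degree_in f V x"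
  proof -
    have "degree_in (clone x y f) V y = (\<Sum>u\<in>V - {x, y}. clone x y f {u, y})"
      unfolding degree_in_def using assms clone_doubleton(2)[of x y f]
      by (intro sum.mono_neutral_right) auto
    also have "\<dots> = (\<Sum>u\<in>V - {x, y}. f {u, x})"
      by (intro sum.cong) (auto simp: clone_doubleton)
    also have "\<dots> = degree_in f V x"
      unfolding degree_in_def using assms
      by (intro sum.mono_neutral_left) (auto simp: insert_commute)
    finally show ?thesis .
  qed
  ultimately show ?thesis
    using pair_sum_remove[OF assms(1,3), of "clone x y f"] pair_sum_remove[OF assms(1,3), of f]
    by simp
qed

text \<open>Clones stay clique-free and so obey Turan's bound, the averaging bound for
  \<open>s = r + 1\<close>. Replacing either vertex by the other cannot raise the total, so the
  degrees agree, and then the total is kept.\<close>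

lemma turan_extremal_clone:
  assumes "r \<ge> 1" "finite V" "card V \<ge> r + 1" "turan_extremal r V f"
    "x \<in> V" "y \<in> V" "x \<noteq> y" "f {x, y} = 0"
  shows "degree_in f V x = degree_in f V y" "turan_extremal r V (clone x y f)"
proof -
  have le: "degree_in f V u \<le> degree_in f V v"
    if "u \<in> V" "v \<in> V" "u \<noteq> v" "f {u, v} = 0" for u v
  proof -
    have "pair_sum (clone u v f) V \<le> turan_number r (card V)"
      using assms that
      by (intro pair_sum_le_turan_number[OF assms(1) order_refl assms(2)] clone_clique_free)
        (auto simp: turan_extremal_def)
    then show ?thesis
      using pair_sum_clone[OF assms(2) that(1,2,3), of f] that assms(4)
      by (simp add: turan_extremal_def)
  qed
  show deg: "degree_in f V x = degree_in f V y"
    using le[of x y] le[of y x] assms by (simp add: insert_commute)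
  show "turan_extremal r V (clone x y f)"
    unfolding turan_extremal_def
  proof (intro conjI ballI allI impI)
    show "clone x y f p \<in> {0, 1}" if "p \<in> nsets V 2" for p
      using assms that by (intro clone_in_01) (auto simp: turan_extremal_def)
    show "pair_sum (clone x y f) X \<le> turan_number r (r + 1)"
      if "X \<subseteq> V" "card X = r + 1" for X
      using assms that by (intro clone_clique_free) (auto simp: turan_extremal_def)
    show "pair_sum (clone x y f) V = turan_number r (card V)"
      using pair_sum_clone[where f = f, OF assms(2,5-8)] deg assms(4) by (simp add: turan_extremal_def)
  qed
qed

text \<open>After \<open>x\<close> has been replaced by a copy of \<open>y\<close>, the vertices \<open>y\<close> and \<open>z\<close> still have equal
  degrees, so \<open>z\<close> cannot have lost the edge to \<open>x\<close>.\<close>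

lemma turan_extremal_nonadjacent_trans:
  assumes "r \<ge> 1" "finite V" "card V \<ge> r + 1" and ext: "turan_extremal r V f"
    and V: "x \<in> V" "y \<in> V" "z \<in> V" and neq: "x \<noteq> y" "y \<noteq> z" "x \<noteq> z"
    and xy: "f {x, y} = 0" and yz: "f {y, z} = 0"
  shows "f {x, z} = 0"
proof -
  let ?g = "clone y x f"
  have yx: "f {y, x} = 0" using xy by (simp add: insert_commute)
  have ext': "turan_extremal r V ?g"
    using turan_extremal_clone(2)[OF assms(1-4) V(2,1)] yx neq by simp
  have unch: "?g {u, v} = f {u, v}" if "u \<noteq> x" "v \<noteq> x" for u v
    using that by (intro clone_unchanged) auto
  \<comment> \<open>Cloning alters only pairs at \<open>x\<close>, so just this one term can change
    in the degrees of \<open>y\<close> and \<open>z\<close>.\<close>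
  have split: "degree_in h V v = h {x, v} + (\<Sum>u\<in>V - {v} - {x}. h {u, v})"
    if "v \<in> V" "v \<noteq> x" for h :: "'a set \<Rightarrow> int" and v
    unfolding degree_in_def using assms(2) V that by (intro sum.remove) auto
  have rest: "(\<Sum>u\<in>V - {v} - {x}. ?g {u, v}) = (\<Sum>u\<in>V - {v} - {x}. f {u, v})" if "v \<noteq> x" for v
    using that unch by (intro sum.cong) auto
  have "?g {x, y} = 0" using clone_doubleton(2)[of y x f] neq by (simp add: insert_commute)
  then have y: "degree_in ?g V y = degree_in f V y"
    using split[of y ?g] split[of y f] rest[of y] V neq xy by simp
  have "?g {x, z} = 0"
    using clone_doubleton(1)[of z y x f] neq yz by (simp add: insert_commute)
  then have z: "degree_in ?g V z = degree_in f V z - f {x, z}"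
    using split[of z ?g] split[of z f] rest[of z] V neq by simp
  have "degree_in f V y = degree_in f V z"
    using turan_extremal_clone(1)[OF assms(1-4) V(2,3) neq(2) yz] .
  moreover have "degree_in ?g V y = degree_in ?g V z"
    using turan_extremal_clone(1)[OF assms(1-3) ext' V(2,3) neq(2)] unch[of y z] neq yz by simp
  ultimately show ?thesis using y z by simp
qed

text \<open>The colours number the classes of non-adjacency; representatives of \<open>r + 1\<close>
  classes would form a clique.\<close>

lemma turan_extremal_colouring:
  fixes f :: "'a set \<Rightarrow> int"
  assumes "r \<ge> 1" "finite V" "card V \<ge> r + 1" and ext: "turan_extremal r V f"
  obtains c :: "'a \<Rightarrow> nat" where "\<And>v. v \<in> V \<Longrightarrow> c v < r"
    "\<And>u v. u \<in> V \<Longrightarrow> v \<in> V \<Longrightarrow> u \<noteq> v \<Longrightarrow> f {u, v} = (if c u = c v then 0 else 1)"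
proof -
  \<comment> \<open>The case \<open>u = v\<close> is listed separately because \<open>{v, v}\<close>
    is not a pair.\<close>
  define N where "N v = {u \<in> V. u = v \<or> f {u, v} = 0}" for v
  have N_eq: "N u = N v \<longleftrightarrow> f {u, v} = 0" if uv: "u \<in> V" "v \<in> V" "u \<noteq> v" for u v
  proof
    assume "N u = N v"
    then have "u \<in> N v" using uv by (auto simp: N_def)
    then show "f {u, v} = 0" using uv by (simp add: N_def)
  next
    have sub: "N u \<subseteq> N v" if "u \<in> V" "v \<in> V" "u \<noteq> v" "f {u, v} = 0" for u v
    proof
      fix w assume "w \<in> N u"
      then have w: "w \<in> V" "w = u \<or> f {w, u} = 0" by (auto simp: N_def)
      show "w \<in> N v"
      proof (cases "w = u \<or> w = v")
        case True
        then show ?thesis using that by (auto simp: N_def)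
      next
        case False
        then have "f {w, v} = 0"
          using w that turan_extremal_nonadjacent_trans[OF assms, of w u v] by auto
        then show ?thesis using w by (simp add: N_def)
      qed
    qed
    assume "f {u, v} = 0"
    then show "N u = N v" using sub[of u v] sub[of v u] uv by (simp add: insert_commute)
  qed
  have "card (N ` V) \<le> r"
  proof (rule ccontr)
    assume "\<not> ?thesis"
    then have "r + 1 \<le> card (N ` V)" by simp
    then obtain T where T: "T \<subseteq> N ` V" "card T = r + 1"
      by (metis obtain_subset_with_card_n)
    then obtain Y where Y: "Y \<subseteq> V" "inj_on N Y" "T = N ` Y"
      by (metis subset_image_inj)
    have cY: "card Y = r + 1" using Y T by (simp add: card_image)
    have "f p = 1" if p: "p \<in> nsets Y 2" for p
    proof -
      obtain u v where uv: "p = {u, v}" "u \<in> Y" "v \<in> Y" "u \<noteq> v"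
        using p by (rule nsets_2_cases)
      then have "f {u, v} \<noteq> 0" using Y N_eq[of u v] by (auto dest: inj_onD)
      moreover have "f p \<in> {0, 1}"
        using ext p nsets_mono[OF Y(1)] unfolding turan_extremal_def by blast
      ultimately show ?thesis using uv(1) by simp
    qed
    then have "pair_sum f Y = (\<Sum>p\<in>nsets Y 2. 1)"
      unfolding pair_sum_def by (intro sum.cong refl)
    then have "pair_sum f Y = int (card (nsets Y 2))" by simp
    also have "\<dots> = int ((r + 1) choose 2)"
      using cY card_nsets[of Y 2] finite_subset[OF Y(1) assms(2)] by simp
    finally have "pair_sum f Y > turan_number r (r + 1)"
      using turan_number_clique[OF assms(1)] by simp
    moreover have "pair_sum f Y \<le> turan_number r (r + 1)"
      using ext Y cY by (auto simp: turan_extremal_def)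
    ultimately show False by simp
  qed
  then obtain g :: "'a set \<Rightarrow> nat" where g: "inj_on g (N ` V)" "g ` (N ` V) \<subseteq> {..<r}"
    using card_le_inj[of "N ` V" "{..<r}"] assms(2) by auto
  show ?thesis
  proof (rule that[of "\<lambda>v. g (N v)"])
    show "g (N v) < r" if "v \<in> V" for v using g that by auto
    show "f {u, v} = (if g (N u) = g (N v) then 0 else 1)"
      if "u \<in> V" "v \<in> V" "u \<noteq> v" for u v
    proof -
      have "g (N u) = g (N v) \<longleftrightarrow> f {u, v} = 0"
        using N_eq[OF that] g(1) that by (auto dest: inj_onD)
      moreover have "f {u, v} \<in> {0, 1}"
        using ext doubleton_in_nsets_2[OF that] by (simp add: turan_extremal_def)
      ultimately show ?thesis by auto
    qed
  qed
qed

section \<open>From sums to products\<close>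

text \<open>An integer \<open>w\<close> lies below the exponential through the points \<open>(a, a)\<close> and
  \<open>(a + 1, a + 1)\<close>.\<close>

definition exp_interp :: "nat \<Rightarrow> nat \<Rightarrow> real" where
  "exp_interp a w = real a * (1 + 1 / real a) powr (real w - real a)"

lemma exp_interp_eq:
  assumes "a \<ge> 1" "w \<in> {a, a + 1}"
  shows "exp_interp a w = real w"
proof -
  have "1 + 1 / real a > 0" by (simp add: add_pos_nonneg)
  then show ?thesis using assms by (auto simp: exp_interp_def field_simps)
qed

text \<open>Bernoulli's inequality serves on both sides of the interpolation points, with base
  \<open>1 + x\<close> above and the reciprocal base \<open>1 - y\<close> below.\<close>

lemma exp_interp_gt:
  assumes "a \<ge> 1" "w \<notin> {a, a + 1}"
  shows "real w < exp_interp a w"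
proof -
  define x where "x = 1 / real a"
  have x: "x > 0" "real a * x = 1" using assms by (auto simp: x_def)
  consider "w \<ge> a + 2" | "w < a" using assms by force
  then show ?thesis
  proof cases
    case 1
    then obtain k where w: "w = a + Suc k" and k: "k \<ge> 1"
      by (metis add_Suc_right le_Suc_ex add.assoc numeral_2_eq_2 add_Suc plus_1_eq_Suc le_add1)
    have "(1 + x) ^ k \<ge> 1 + real k * x" using x by (intro Bernoulli_inequality) simp
    then have "(1 + x) * (1 + x) ^ k \<ge> (1 + x) * (1 + real k * x)"
      using x by (intro mult_left_mono) auto
    \<comment> \<open>The cross term \<open>k * x * x\<close> gives strictness, as
      \<open>k \<ge> 1\<close> excludes \<open>w = a + 1\<close>.\<close>
    moreover have "(1 + x) * (1 + real k * x) > 1 + real (Suc k) * x"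
      using x k by (simp add: algebra_simps)
    ultimately have "1 + real (Suc k) * x < (1 + x) ^ Suc k" by simp
    then have "real a * (1 + real (Suc k) * x) < real a * (1 + x) ^ Suc k"
      using assms by (intro mult_strict_left_mono) auto
    moreover have "real a * (1 + real (Suc k) * x) = real w"
      using x(2) by (simp add: w algebra_simps)
    moreover have "exp_interp a w = real a * (1 + x) ^ Suc k"
      using x by (simp add: exp_interp_def w x_def[symmetric] powr_realpow[symmetric] del: power_Suc)
    ultimately show ?thesis by simp
  next
    case 2
    then obtain k where a: "a = w + k" and k: "k \<ge> 1"
      by (metis less_imp_add_positive less_eq_Suc_le One_nat_def)
    \<comment> \<open>Thus \<open>1 - y = a / (a + 1)\<close> is the reciprocal of
      \<open>1 + x\<close>; strictness will come from \<open>a * y < 1\<close>.\<close>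
    define y where "y = 1 / (real a + 1)"
    have y: "1 + x = 1 / (1 - y)" "y \<le> 1" "y < 1"
      using assms by (auto simp: x_def y_def field_simps)
    have "(1 + (- y)) ^ k \<ge> 1 + real k * (- y)" using y by (intro Bernoulli_inequality) simp
    then have "real a * (1 - y) ^ k \<ge> real a * (1 - real k * y)"
      by (intro mult_left_mono) auto
    moreover have "real a * (1 - real k * y) > real a - real k"
      using k assms by (simp add: y_def field_simps)
    moreover have "exp_interp a w = real a * (1 - y) ^ k"
    proof -
      have "real w - real a = - real k" using a by simp
      then have "exp_interp a w = real a * (1 / (1 - y)) powr (- real k)"
        unfolding exp_interp_def x_def[symmetric] y(1) by simp
      also have "(1 / (1 - y)) powr (- real k) = (1 - y) powr real k"
        using y by (simp add: powr_divide powr_minus field_simps)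
      finally show ?thesis using y by (simp add: powr_realpow)
    qed
    ultimately show ?thesis using a by simp
  qed
qed

text \<open>The product of the bounds depends only on the number of pairs and the total excess,
  which links products to sums.\<close>

lemma prod_exp_interp:
  assumes "finite A" "a \<ge> 1"
  shows "(\<Prod>p\<in>A. exp_interp a (w p)) =
    real a ^ card A * (1 + 1 / real a) powr real_of_int (\<Sum>p\<in>A. int (w p) - int a)"
proof -
  have "1 + 1 / real a > 0" by (simp add: add_pos_nonneg)
  then show ?thesis using assms(1)
    by (simp add: exp_interp_def prod.distrib powr_sum)
qed

lemma prod_le_exp_interp:
  assumes "finite A" "a \<ge> 1"
  shows "real (\<Prod>p\<in>A. w p) \<le> (\<Prod>p\<in>A. exp_interp a (w p))"
  unfolding of_nat_prod using exp_interp_eq exp_interp_gt assms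
  by (intro prod_mono) (metis less_imp_le of_nat_0_le_iff order_refl)

lemma prod_eq_exp_interp_iff:
  assumes "finite A" "a \<ge> 1"
  shows "real (\<Prod>p\<in>A. w p) = (\<Prod>p\<in>A. exp_interp a (w p)) \<longleftrightarrow> (\<forall>p\<in>A. w p \<in> {a, a + 1})"
proof
  assume eq: "real (\<Prod>p\<in>A. w p) = (\<Prod>p\<in>A. exp_interp a (w p))"
  have le: "real (w p) \<le> exp_interp a (w p)" for p
    using exp_interp_eq exp_interp_gt assms(2) by (metis less_imp_le order_refl)
  have pos: "exp_interp a (w p) > 0" for p
  proof -
    have "1 + 1 / real a > 0" by (simp add: add_pos_nonneg)
    then show ?thesis using assms(2) by (simp add: exp_interp_def)
  qed
  show "\<forall>p\<in>A. w p \<in> {a, a + 1}"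
  proof (rule ccontr)
    assume "\<not> ?thesis"
    then obtain p where p: "p \<in> A" "w p \<notin> {a, a + 1}" by blast
    have "real (\<Prod>p\<in>A. w p) = real (w p) * (\<Prod>p\<in>A - {p}. real (w p))"
      using p assms by (simp add: prod.remove)
    \<comment> \<open>The other factors pass to their interpolants first: these are positive,
      whereas a vanishing \<open>w p\<close> would hide the strict factor.\<close>
    also have "\<dots> \<le> real (w p) * (\<Prod>p\<in>A - {p}. exp_interp a (w p))"
      using le by (intro mult_left_mono prod_mono) auto
    also have "\<dots> < exp_interp a (w p) * (\<Prod>p\<in>A - {p}. exp_interp a (w p))"
      using exp_interp_gt[OF assms(2) p(2)] pos by (intro mult_strict_right_mono prod_pos) auto
    also have "\<dots> = (\<Prod>p\<in>A. exp_interp a (w p))"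
      using p assms by (simp add: prod.remove)
    finally show False using eq by simp
  qed
next
  assume "\<forall>p\<in>A. w p \<in> {a, a + 1}"
  then show "real (\<Prod>p\<in>A. w p) = (\<Prod>p\<in>A. exp_interp a (w p))"
    using exp_interp_eq[OF assms(2)] by (simp add: of_nat_prod del: insert_iff)
qed

section \<open>Multigraphs\<close>

definition excess :: "nat \<Rightarrow> nat multigraph \<Rightarrow> nat set \<Rightarrow> int" where
  "excess a G p = int (snd G p) - int a"

lemma edges_in_excess:
  assumes "finite X"
  shows "int (edges_in G X) = int a * int (card X choose 2) + pair_sum (excess a G) X"
  using card_nsets[OF assms, of 2]
  by (simp add: edges_in_def pair_sum_def excess_def sum_subtractf)

text \<open>With \<open>d = 0\<close> part 0 is like all others, so a partition into possibly empty
  parts amounts to a colouring with colours below \<open>r\<close>.\<close>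

lemma turan_family_iff:
  assumes "r \<ge> 1"
  shows "G \<in> turan_family r 0 a n \<longleftrightarrow> G \<in> multigraphs_on n \<and>
    (\<exists>c. (\<forall>v\<in>{1..n}. c v < r) \<and> (\<forall>u\<in>{1..n}. \<forall>v\<in>{1..n}. u \<noteq> v \<longrightarrow>
      excess a G {u, v} = (if c u = c v then 0 else 1)))" (is "?L \<longleftrightarrow> ?R")
proof
  assume ?L
  then obtain V where G: "G \<in> multigraphs_on n" and cover: "(\<Union>i<r. V i) = {1..n}"
    and disj: "disjoint_family_on V {..<r}"
    and V0: "\<forall>p \<in> nsets (V 0) 2. snd G p = a"
    and Vi: "\<forall>i \<in> {1..<r}. \<forall>p \<in> nsets (V i) 2. snd G p = a"
    and cross: "\<forall>p \<in> nsets {1..n} 2. (\<forall>i<r. \<not> p \<subseteq> V i) \<longrightarrow> snd G p = a + 1"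
    by (auto simp: turan_family_def)
  have "\<forall>v\<in>{1..n}. \<exists>i<r. v \<in> V i" unfolding cover[symmetric] by auto
  then obtain c where c: "\<forall>v\<in>{1..n}. c v < r \<and> v \<in> V (c v)" by metis
  have uniq: "i = c v" if "v \<in> V i" "i < r" for v i
  proof -
    have "v \<in> {1..n}" unfolding cover[symmetric] using that by auto
    then show ?thesis using disj c that unfolding disjoint_family_on_def by blast
  qed
  have inner: "snd G p = a" if "i < r" "p \<in> nsets (V i) 2" for i p
    using V0 Vi that by (cases "i = 0") auto
  have "excess a G {u, v} = (if c u = c v then 0 else 1)"
    if uv: "u \<in> {1..n}" "v \<in> {1..n}" "u \<noteq> v" for u v
  proof (cases "c u = c v")
    case True
    have "u \<in> V (c u)" "v \<in> V (c u)" using c uv True by metis+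
    then have "snd G {u, v} = a"
      using uv c by (intro inner[of "c u"] doubleton_in_nsets_2) auto
    then show ?thesis using True by (simp add: excess_def)
  next
    case False
    then have "\<forall>i<r. \<not> {u, v} \<subseteq> V i" using uniq by auto
    then have "snd G {u, v} = a + 1"
      using cross uv doubleton_in_nsets_2[OF uv] by blast
    then show ?thesis using False by (simp add: excess_def)
  qed
  then show ?R using G c by blast
next
  assume ?R
  then obtain c where G: "G \<in> multigraphs_on n" and c: "\<forall>v\<in>{1..n}. c v < r"
    and ex: "\<And>u v. u \<in> {1..n} \<Longrightarrow> v \<in> {1..n} \<Longrightarrow> u \<noteq> v \<Longrightarrow>
      excess a G {u, v} = (if c u = c v then 0 else 1)"
    by blast
  define V where "V i = {v \<in> {1..n}. c v = i}" for i
  have inner: "snd G p = a" if "p \<in> nsets (V i) 2" for i p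
    using that
  proof (rule nsets_2_cases)
    fix u v assume "p = {u, v}" "u \<in> V i" "v \<in> V i" "u \<noteq> v"
    then show ?thesis using ex[of u v] by (simp add: V_def excess_def)
  qed
  have cross: "snd G p = a + 1" if p: "p \<in> nsets {1..n} 2" "\<forall>i<r. \<not> p \<subseteq> V i" for p
    using p(1)
  proof (rule nsets_2_cases)
    fix u v assume uv: "p = {u, v}" "u \<in> {1..n}" "v \<in> {1..n}" "u \<noteq> v"
    then have "c u \<noteq> c v" using p(2) c by (auto simp: V_def)
    then show ?thesis using ex[of u v] uv by (simp add: excess_def)
  qed
  have "(\<Union>i<r. V i) = {1..n}" using c by (auto simp: V_def)
  moreover have "disjoint_family_on V {..<r}" by (auto simp: V_def disjoint_family_on_def)
  ultimately show ?L
    unfolding turan_family_def using G inner cross by (auto intro!: exI[of _ V])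
qed

lemma multigraphs_on_fst: "G \<in> multigraphs_on n \<Longrightarrow> fst G = {1..n}"
  by (simp add: multigraphs_on_def)

text \<open>Among \<open>r + 1\<close> vertices two share a colour, which costs a pair; larger sets
  follow by averaging with \<open>s = r + 1\<close>.\<close>

lemma turan_family_pair_sum_le:
  assumes "r \<ge> 1" "G \<in> turan_family r 0 a n" "X \<subseteq> {1..n}" "card X \<ge> r + 1"
  shows "pair_sum (excess a G) X \<le> turan_number r (card X)"
proof -
  obtain c where c: "\<And>v. v \<in> {1..n} \<Longrightarrow> c v < r"
    and ex: "\<And>u v. u \<in> {1..n} \<Longrightarrow> v \<in> {1..n} \<Longrightarrow> u \<noteq> v \<Longrightarrow>
      excess a G {u, v} = (if c u = c v then 0 else 1)"
    using assms(2) unfolding turan_family_iff[OF assms(1)] by blast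
  have "pair_sum (excess a G) Y \<le> turan_number r (r + 1)"
    if Y: "Y \<subseteq> {1..n}" "card Y = r + 1" for Y
  proof -
    have finY: "finite Y" using Y finite_subset by blast
    have "c ` Y \<subseteq> {..<r}" using c Y by auto
    then have "card (c ` Y) \<le> r" using card_mono[of "{..<r}" "c ` Y"] by simp
    then have "\<not> inj_on c Y" using Y card_image[of c Y] by auto
    then obtain u v where uv: "u \<in> Y" "v \<in> Y" "u \<noteq> v" "c u = c v"
      by (auto simp: inj_on_def)
    have "excess a G p \<le> 1" if "p \<in> nsets Y 2" for p
      using that
    proof (rule nsets_2_cases)
      fix u v assume "p = {u, v}" "u \<in> Y" "v \<in> Y" "u \<noteq> v"
      then show ?thesis using ex[of u v] subsetD[OF Y(1)] by simp
    qed
    moreover have "excess a G {u, v} = 0" using ex[of u v] uv subsetD[OF Y(1)] by simp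
    ultimately have "pair_sum (excess a G) Y \<le> int (card Y choose 2) - 1"
      using uv finY by (intro pair_sum_le_choose[of _ _ "{u, v}"]) (auto intro: doubleton_in_nsets_2)
    then show ?thesis using Y turan_number_clique[OF assms(1)] by simp
  qed
  then show ?thesis
    using assms by (intro pair_sum_le_turan_number[of r "r + 1" "{1..n}"]) auto
qed

section \<open>The balanced graph given by residues modulo \<open>r\<close>\<close>

lemma card_same_residue:
  assumes "r \<ge> 1"
  shows "card {u \<in> {1..m}. u mod r = Suc m mod r} = m div r"
proof -
  \<comment> \<open>These vertices are reached from \<open>Suc m\<close> by going down in steps of
    \<open>r\<close>.\<close>
  have "{u \<in> {1..m}. u mod r = Suc m mod r} = (\<lambda>i. Suc m - r * i) ` {1..m div r}"
  proof (intro equalityI subsetI)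
    fix u assume "u \<in> {u \<in> {1..m}. u mod r = Suc m mod r}"
    then have u: "1 \<le> u" "u \<le> m" "Suc m mod r = u mod r" by auto
    then have "r dvd Suc m - u" using mod_eq_dvd_iff_nat[of u "Suc m" r] by simp
    then obtain i where i: "Suc m - u = r * i" by blast
    have "i \<ge> 1" using i u by (cases i) auto
    moreover have "i * r \<le> m" using i u by (simp add: mult.commute)
    then have "i \<le> m div r" using assms by (simp add: less_eq_div_iff_mult_less_eq)
    moreover have "u = Suc m - r * i" using i u by linarith
    ultimately show "u \<in> (\<lambda>i. Suc m - r * i) ` {1..m div r}" by auto
  next
    fix u assume "u \<in> (\<lambda>i. Suc m - r * i) ` {1..m div r}"
    then obtain i where i: "u = Suc m - r * i" "1 \<le> i" "i \<le> m div r" by auto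
    have "r * i \<le> m" using i assms by (simp add: less_eq_div_iff_mult_less_eq mult.commute)
    moreover have "r * i \<ge> 1" using i assms by simp
    moreover have "Suc m = u + r * i" using i \<open>r * i \<le> m\<close> by simp
    then have "u mod r = Suc m mod r" by simp
    moreover have "1 \<le> u" "u \<le> m" using \<open>Suc m = u + r * i\<close> calculation(1,2) by linarith+
    ultimately show "u \<in> {u \<in> {1..m}. u mod r = Suc m mod r}" by simp
  qed
  moreover have "inj_on (\<lambda>i. Suc m - r * i) {1..m div r}"
  proof (rule inj_onI)
    fix i j assume ij: "i \<in> {1..m div r}" "j \<in> {1..m div r}" "Suc m - r * i = Suc m - r * j"
    have "r * i \<le> m" "r * j \<le> m"
      using ij assms by (auto simp: less_eq_div_iff_mult_less_eq mult.commute)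
    then have "r * i = r * j" using ij(3) by linarith
    then show "i = j" using assms by simp
  qed
  ultimately show ?thesis by (simp add: card_image)
qed

text \<open>Under colouring by residues, vertex \<open>Suc m\<close> has exactly
  \<open>m div r\<close> earlier vertices in its class, which matches the increment of
  \<open>turan_number\<close>.\<close>

lemma balanced_turan_graph:
  assumes "r \<ge> 1"
  obtains G where "G \<in> turan_family r 0 a n" "pair_sum (excess a G) {1..n} = turan_number r n"
proof -
  \<comment> \<open>Written as a function of the set \<open>p\<close>: a pair is monochromatic when
    its image is a singleton.\<close>
  define h where "h p = (if card ((\<lambda>v. v mod r) ` p) = 1 then 0 else 1 :: nat)" for p
  define G where "G = ({1..n}, restrict (\<lambda>p. a + h p) (nsets {1..n} 2))"
  have h: "h {u, v} = (if u mod r = v mod r then 0 else 1)" for u v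
    by (auto simp: h_def card_insert_if)
  have exc: "excess a G p = int (h p)" if "p \<in> nsets {1..n} 2" for p
    using that by (simp add: excess_def G_def)
  have "G \<in> multigraphs_on n"
    by (auto simp: G_def multigraphs_on_def multigraph_def)
  moreover have "\<forall>v\<in>{1..n}. v mod r < r" using assms by simp
  moreover have "\<forall>u\<in>{1..n}. \<forall>v\<in>{1..n}. u \<noteq> v \<longrightarrow>
      excess a G {u, v} = (if u mod r = v mod r then 0 else 1)"
    using exc doubleton_in_nsets_2 h by simp
  ultimately have G: "G \<in> turan_family r 0 a n"
    unfolding turan_family_iff[OF assms] by (intro conjI exI[of _ "\<lambda>v. v mod r"])
  have "pair_sum (\<lambda>p. int (h p)) {1..m} = turan_number r m" for m
  proof (induction m)
    case 0
    have "nsets {} 2 = ({} :: nat set set)" by (auto simp: nsets_def)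
    then show ?case by (simp add: pair_sum_def turan_number_def)
  next
    case (Suc m)
    have "(\<Sum>u\<in>{1..m}. int (h {u, Suc m})) =
        (\<Sum>u\<in>{1..m}. 1 - (if u mod r = Suc m mod r then 1 else 0))"
      by (intro sum.cong) (auto simp: h)
    also have "\<dots> = int m - int (card {u \<in> {1..m}. u mod r = Suc m mod r})"
      by (simp add: sum_subtractf sum.If_cases Int_def)
    also have "\<dots> = int m - int (m div r)" by (simp only: card_same_residue[OF assms])
    finally show ?case
      using Suc pair_sum_insert[of "{1..m}" "Suc m" "\<lambda>p. int (h p)"]
      by (simp add: turan_number_Suc atLeastAtMostSuc_conv)
  qed
  moreover have "pair_sum (excess a G) {1..n} = pair_sum (\<lambda>p. int (h p)) {1..n}"
    unfolding pair_sum_def using exc by (intro sum.cong) auto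
  ultimately show ?thesis using that G by simp
qed

lemma turan_sum_eq:
  assumes "r \<ge> 1" "s \<ge> r + 1"
  shows "int (turan_sum r 0 a s) = int a * int (s choose 2) + turan_number r s"
proof -
  have edges: "int (edges G) = int a * int (s choose 2) + pair_sum (excess a G) {1..s}"
    if "G \<in> turan_family r 0 a s" for G
  proof -
    have "fst G = {1..s}" using that by (auto simp: turan_family_def multigraphs_on_def)
    then show ?thesis using edges_in_excess[of "{1..s}" G a] by (simp add: edges_def)
  qed
  have le: "int (edges G) \<le> int a * int (s choose 2) + turan_number r s"
    if "G \<in> turan_family r 0 a s" for G
    using edges[OF that] turan_family_pair_sum_le[OF assms(1) that, of "{1..s}"] assms(2) by simp
  obtain B where B: "B \<in> turan_family r 0 a s" "pair_sum (excess a B) {1..s} = turan_number r s"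
    using balanced_turan_graph[OF assms(1)] by blast
  have "turan_sum r 0 a s = edges B"
    unfolding turan_sum_def
  proof (intro Max_eqI)
    \<comment> \<open>The upper bound also yields the finiteness that \<open>Max\<close>
      needs.\<close>
    have le': "edges G \<le> edges B" if "G \<in> turan_family r 0 a s" for G
      using le[OF that] edges[OF B(1)] B(2) by linarith
    then show "finite (edges ` turan_family r 0 a s)"
      by (auto intro!: finite_subset[OF _ finite_atMost[of "edges B"]])
    show "\<And>y. y \<in> edges ` turan_family r 0 a s \<Longrightarrow> y \<le> edges B" using le' by auto
  qed (use B in auto)
  then show ?thesis using edges[OF B(1)] B(2) by simp
qed

section \<open>Bounded families and their largest edge product\<close>

lemma bounded_family_iff:
  assumes "r \<ge> 1" "s \<ge> r + 1"
  shows "G \<in> bounded_family n s (turan_sum r 0 a s) \<longleftrightarrow> G \<in> multigraphs_on n \<and>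
    (\<forall>X. X \<subseteq> {1..n} \<longrightarrow> card X = s \<longrightarrow> pair_sum (excess a G) X \<le> turan_number r s)"
proof -
  have "edges_in G X \<le> turan_sum r 0 a s \<longleftrightarrow> pair_sum (excess a G) X \<le> turan_number r s"
    if "X \<subseteq> {1..n}" "card X = s" for X
  proof -
    have "finite X" using that finite_subset by blast
    then show ?thesis
      using edges_in_excess[of X G a] turan_sum_eq[OF assms, of a] that(2) by auto
  qed
  moreover have "nsets {1..n} s = {X. X \<subseteq> {1..n} \<and> card X = s}"
    by (auto simp: nsets_def intro: finite_subset)
  ultimately show ?thesis by (auto simp: bounded_family_def)
qed

text \<open>For \<open>a \<ge> 1\<close> this is \<open>a ^ (N - t) * (a + 1) ^ t\<close> with
  \<open>N = n choose 2\<close> and \<open>t = turan_number r n\<close>, in the form of a product of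
  interpolants.\<close>

definition turan_prod_value :: "nat \<Rightarrow> nat \<Rightarrow> nat \<Rightarrow> real" where
  "turan_prod_value r a n =
     real a ^ (n choose 2) * (1 + 1 / real a) powr real_of_int (turan_number r n)"

lemma prod_exp_interp_excess:
  assumes "a \<ge> 1" "G \<in> multigraphs_on n"
  shows "(\<Prod>p\<in>nsets (fst G) 2. exp_interp a (snd G p)) =
    real a ^ (n choose 2) * (1 + 1 / real a) powr real_of_int (pair_sum (excess a G) {1..n})"
  using prod_exp_interp[OF _ assms(1), of "nsets {1..n} 2" "snd G"] multigraphs_on_fst[OF assms(2)]
    card_nsets[of "{1..n}" 2]
  by (simp add: finite_imp_finite_nsets pair_sum_def excess_def)

text \<open>Two bounds are chained: multiplicities by interpolants, then the total excess by the
  Turan number. Equality in the first fixes the multiplicities, in the second the total.\<close>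

lemma edge_prod_le_turan_prod_value:
  assumes "a \<ge> 1" "G \<in> multigraphs_on n" "pair_sum (excess a G) {1..n} \<le> turan_number r n"
  shows "real (edge_prod G) \<le> turan_prod_value r a n"
    and "real (edge_prod G) = turan_prod_value r a n \<longleftrightarrow>
      (\<forall>p\<in>nsets {1..n} 2. excess a G p \<in> {0, 1}) \<and>
      pair_sum (excess a G) {1..n} = turan_number r n"
proof -
  have fst: "fst G = {1..n}" using assms(2) by (rule multigraphs_on_fst)
  have fin: "finite (nsets (fst G) 2)" by (simp add: fst finite_imp_finite_nsets)
  let ?I = "\<Prod>p\<in>nsets (fst G) 2. exp_interp a (snd G p)"
  have base: "1 + 1 / real a > 1" using assms by simp
  have le1: "real (edge_prod G) \<le> ?I"
    unfolding edge_prod_def using fin assms(1) by (rule prod_le_exp_interp)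
  have le2: "?I \<le> turan_prod_value r a n"
    unfolding prod_exp_interp_excess[OF assms(1,2)] turan_prod_value_def
    using assms(3) base by (intro mult_left_mono powr_mono) auto
  show "real (edge_prod G) \<le> turan_prod_value r a n" using le1 le2 by linarith
  have eq1: "real (edge_prod G) = ?I \<longleftrightarrow> (\<forall>p\<in>nsets {1..n} 2. excess a G p \<in> {0, 1})"
  proof -
    have "snd G p \<in> {a, a + 1} \<longleftrightarrow> excess a G p \<in> {0, 1}" for p
      by (auto simp: excess_def)
    then show ?thesis
      using prod_eq_exp_interp_iff[OF fin assms(1), of "snd G"] unfolding edge_prod_def fst
      by blast
  qed
  have eq2: "?I = turan_prod_value r a n \<longleftrightarrow> pair_sum (excess a G) {1..n} = turan_number r n"
    unfolding prod_exp_interp_excess[OF assms(1,2)] turan_prod_value_def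
    using assms(1) powr_inj[of "1 + 1 / real a"] order.strict_trans[OF zero_less_one base] by simp
  show "real (edge_prod G) = turan_prod_value r a n \<longleftrightarrow>
      (\<forall>p\<in>nsets {1..n} 2. excess a G p \<in> {0, 1}) \<and>
      pair_sum (excess a G) {1..n} = turan_number r n"
    using le1 le2 eq1 eq2 by force
qed

theorem theorem3p10:
  fixes a r s n :: nat
  assumes "a \<ge> 1" and "r \<ge> 1" and "s \<ge> r + 1"
    and "real n \<ge> 2 * real r * (real s + 2) + real r * (real s + 2) * sqrt (real s - 1)"
  shows "ex_prod n s (turan_sum r 0 a s) = turan_prod r 0 a n \<and>
    {G \<in> bounded_family n s (turan_sum r 0 a s). edge_prod G = ex_prod n s (turan_sum r 0 a s)}
      = turan_prod_extremal r 0 a n"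
proof -
  let ?F = "bounded_family n s (turan_sum r 0 a s)"
  let ?T = "turan_family r 0 a n"
  let ?M = "turan_prod_value r a n"
  \<comment> \<open>The bound on \<open>n\<close> is brought into the form
    \<open>n \<ge> 2 * r * s\<close> that \<open>extremal_clique_free\<close> takes.\<close>
  have "real r * (real s + 2) * sqrt (real s - 1) \<ge> 0" using assms by simp
  then have "real n \<ge> real (2 * r * (s + 2))" using assms(4)
    unfolding of_nat_mult of_nat_add of_nat_numeral by linarith
  then have "n \<ge> 2 * r * (s + 2)" by (simp only: of_nat_le_iff)
  then have n: "n \<ge> 2 * r * s" by (simp add: algebra_simps)
  have "1 * s \<le> 2 * r * s" using assms by (intro mult_right_mono) auto
  then have sn: "s \<le> n" using n by linarith
  have sub: "?T \<subseteq> ?F"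
  proof
    fix G assume G: "G \<in> ?T"
    then have "G \<in> multigraphs_on n" by (simp add: turan_family_def)
    then show "G \<in> ?F"
      unfolding bounded_family_iff[OF assms(2,3)]
      using turan_family_pair_sum_le[OF assms(2) G] assms(3) by auto
  qed
  have F: "G \<in> multigraphs_on n" "pair_sum (excess a G) {1..n} \<le> turan_number r n"
    if "G \<in> ?F" for G
  proof -
    have G: "G \<in> multigraphs_on n"
      "\<And>X. X \<subseteq> {1..n} \<Longrightarrow> card X = s \<Longrightarrow> pair_sum (excess a G) X \<le> turan_number r s"
      using that unfolding bounded_family_iff[OF assms(2,3)] by auto
    show "G \<in> multigraphs_on n" by fact
    show "pair_sum (excess a G) {1..n} \<le> turan_number r n"
      using pair_sum_le_turan_number[OF assms(2,3), of "{1..n}" "excess a G" "{1..n}"] G(2) sn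
      by simp
  qed
  have le: "real (edge_prod G) \<le> ?M" if "G \<in> ?F" for G
    using edge_prod_le_turan_prod_value(1)[OF assms(1) F[OF that]] .
  \<comment> \<open>In the equality case both bounds are tight, so the excess is an extremal
    weighting and its colouring gives the partition.\<close>
  have in_T: "G \<in> ?T" if G: "G \<in> ?F" "real (edge_prod G) = ?M" for G
  proof -
    have eq: "\<forall>p\<in>nsets {1..n} 2. excess a G p \<in> {0, 1}"
      "pair_sum (excess a G) {1..n} = turan_number r n"
      using edge_prod_le_turan_prod_value(2)[OF assms(1) F[OF G(1)]] G(2) by auto
    have bound: "\<And>X. X \<subseteq> {1..n} \<Longrightarrow> card X = s \<Longrightarrow>
        pair_sum (excess a G) X \<le> turan_number r s"
      using G(1) unfolding bounded_family_iff[OF assms(2,3)] by auto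
    have ext: "turan_extremal r {1..n} (excess a G)"
      unfolding turan_extremal_def
    proof (intro conjI allI impI)
      fix X assume "X \<subseteq> {1..n}" "card X = r + 1"
      then show "pair_sum (excess a G) X \<le> turan_number r (r + 1)"
        using n eq(2) by (intro extremal_clique_free[OF assms(2,3) _ _ bound]) auto
    qed (use eq in auto)
    have "card {1..n} \<ge> r + 1" using sn assms(3) by simp
    then obtain c :: "nat \<Rightarrow> nat" where c: "\<And>v. v \<in> {1..n} \<Longrightarrow> c v < r"
      "\<And>u v. u \<in> {1..n} \<Longrightarrow> v \<in> {1..n} \<Longrightarrow> u \<noteq> v \<Longrightarrow>
        excess a G {u, v} = (if c u = c v then 0 else 1)"
      using turan_extremal_colouring[OF assms(2) finite_atLeastAtMost _ ext] by blast
    then show ?thesis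
      unfolding turan_family_iff[OF assms(2)] using F(1)[OF G(1)] by (auto intro!: exI[of _ c])
  qed
  \<comment> \<open>The balanced graph lies in both families and attains \<open>?M\<close>, so it
    realises both maxima.\<close>
  obtain B where B: "B \<in> ?T" "pair_sum (excess a B) {1..n} = turan_number r n"
    using balanced_turan_graph[OF assms(2)] by blast
  have BF: "B \<in> ?F" using B sub by blast
  have "excess a B p \<in> {0, 1}" if "p \<in> nsets {1..n} 2" for p
    using that
  proof (rule nsets_2_cases)
    fix u v assume "p = {u, v}" "u \<in> {1..n}" "v \<in> {1..n}" "u \<noteq> v"
    then show ?thesis using B(1) unfolding turan_family_iff[OF assms(2)] by (metis insertCI)
  qed
  then have BM: "real (edge_prod B) = ?M"
    using edge_prod_le_turan_prod_value(2)[OF assms(1) F[OF BF]] B(2) by blast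
  have Max_eq: "Max (edge_prod ` A) = edge_prod B" if "A \<subseteq> ?F" "B \<in> A" for A
  proof (intro Max_eqI)
    have le': "edge_prod G \<le> edge_prod B" if "G \<in> A" for G
      using le[of G] BM that \<open>A \<subseteq> ?F\<close> by (metis of_nat_le_iff subsetD)
    then show "finite (edge_prod ` A)"
      by (auto intro!: finite_subset[OF _ finite_atMost[of "edge_prod B"]])
    show "\<And>y. y \<in> edge_prod ` A \<Longrightarrow> y \<le> edge_prod B" using le' by auto
  qed (use that in auto)
  have ex: "ex_prod n s (turan_sum r 0 a s) = edge_prod B"
    unfolding ex_prod_def using BF by (intro Max_eq) auto
  have tp: "turan_prod r 0 a n = edge_prod B"
    unfolding turan_prod_def using B sub by (intro Max_eq) auto
  show ?thesis
    unfolding turan_prod_extremal_def ex tp using in_T BM sub by auto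
qed

end
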